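(* Let $(H,m,1,\Delta,\varepsilon,t,\phi)$ be a biFrobenius algebra over a field $\Bbbk$ with antipode $\mathcal S$. Then $$\operatorname{tr}(\mathcal S^2)=\phi\big((\operatorname{id}\star\mathcal S)(t)\big),$$ where $(\operatorname{id}\star\mathcal S)(t)=\sum t_1\,\mathcal S(t_2)$. Moreover, if $H$ is of type $S$, then $$\operatorname{tr}(\mathcal S^2)=\varepsilon(t)\phi(1).$$
   Context: Let $\Bbbk$ be a field, $(H,m,1)$ an associative unital $\Bbbk$-algebra and $(H,\Delta,\varepsilon)$ a coassociative counital $\Bbbk$-coalgebra on the same vector space (no compatibility between $m$ and $\Delta$ is assumed beyond what is stated below). Sweedler notation is used: $\Delta(x)=\sum x_1\otimes x_2$. Actions, for $x,y\in H$, $\lambda\in H^*$: $(\lambda\leftharpoonup x)(y)=\lambda(xy)$ and $x\leftharpoonup\lambda=\sum\lambda(x_1)x_2$. BiFrobenius algebra: let $\phi\in H^*$ and $t\in H$. The tuple $(H,m,1,\Delta,\varepsilon,t,\phi)$ is a biFrobenius algebra if: (1) $H^*=\phi\leftharpoonup H$ (Frobenius algebra) and $H=t\leftharpoonup H^*$ (coFrobenius coalgebra); in particular $H$ is finite dimensional; (2) $1$ is a group-like element ($\Delta(1)=1\otimes 1$, $\varepsilon(1)=1$) and $\varepsilon$ is an algebra homomorphism; (3) $t\leftharpoonup\phi=1$ and $\phi\leftharpoonup t=\varepsilon$; then $tx=\varepsilon(x)t$ and $\phi(x)1=\sum\phi(x_1)x_2$ for all $x\in H$, and $\phi(t)=1$;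 (4) the map $\mathcal S:H\to H$, $\mathcal S(x)=\sum\phi(t_1x)t_2$ (the antipode), is an antiautomorphism of algebras and of coalgebras. For linear maps $f,g:H\to H$, the convolution product is $(f\star g)(x)=\sum f(x_1)g(x_2)$. The biFrobenius algebra $H$ is of type $S$ (an SbF algebra) if $\mathcal S$ is the convolution inverse of the identity in $\operatorname{End}_\Bbbk(H)$, i.e. $\sum\mathcal S(x_1)x_2=\sum x_1\mathcal S(x_2)=\varepsilon(x)1$ for all $x\in H$. Here $\operatorname{tr}$ is the trace of a linear endomorphism of $H$. *)

theory Defs
  imports Complex_Main
begin

text \<open>
  The library has no tensor products of vector spaces over an arbitrary field.  An element of
  \<open>H \<otimes> H\<close> is represented by a list of pairs, \<open>[(a, b), (a', b'), \<dots>]\<close> standing for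
  \<open>a \<otimes> b + a' \<otimes> b' + \<dots>\<close>, and \<open>H \<otimes> H\<close> itself is the quotient of these formal sums by the
  congruence \<open>tensor2_eq\<close> generated by the defining relations of the tensor product; likewise
  with triples for \<open>H \<otimes> H \<otimes> H\<close>.  The negative of \<open>x \<otimes> y\<close> is \<open>(- x) \<otimes> y\<close>, and scalars are
  absorbed into the first factor, so that formal sums need no coefficients.
\<close>

inductive formal_sum_eq :: "('b list \<Rightarrow> 'b list \<Rightarrow> bool) \<Rightarrow> 'b list \<Rightarrow> 'b list \<Rightarrow> bool"
  for R :: "'b list \<Rightarrow> 'b list \<Rightarrow> bool" where
  base: "R us vs \<Longrightarrow> formal_sum_eq R us vs"
| refl: "formal_sum_eq R us us"
| sym: "formal_sum_eq R us vs \<Longrightarrow> formal_sum_eq R vs us"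
| trans: "formal_sum_eq R us vs \<Longrightarrow> formal_sum_eq R vs ws \<Longrightarrow> formal_sum_eq R us ws"
| append: "formal_sum_eq R us us' \<Longrightarrow> formal_sum_eq R vs vs' \<Longrightarrow>
    formal_sum_eq R (us @ vs) (us' @ vs')"
| commute: "formal_sum_eq R (us @ vs) (vs @ us)"

inductive tensor2_rel ::
  "('k \<Rightarrow> 'a \<Rightarrow> 'a) \<Rightarrow> ('a::ab_group_add \<times> 'a) list \<Rightarrow> ('a \<times> 'a) list \<Rightarrow> bool"
  for scale :: "'k \<Rightarrow> 'a \<Rightarrow> 'a" where
  add1: "tensor2_rel scale [(x + x', y)] [(x, y), (x', y)]"
| add2: "tensor2_rel scale [(x, y + y')] [(x, y), (x, y')]"
| scale12: "tensor2_rel scale [(scale c x, y)] [(x, scale c y)]"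
| zero: "tensor2_rel scale [(0, y)] []"

inductive tensor3_rel ::
  "('k \<Rightarrow> 'a \<Rightarrow> 'a) \<Rightarrow> ('a::ab_group_add \<times> 'a \<times> 'a) list \<Rightarrow> ('a \<times> 'a \<times> 'a) list \<Rightarrow> bool"
  for scale :: "'k \<Rightarrow> 'a \<Rightarrow> 'a" where
  add1: "tensor3_rel scale [(x + x', y, z)] [(x, y, z), (x', y, z)]"
| add2: "tensor3_rel scale [(x, y + y', z)] [(x, y, z), (x, y', z)]"
| add3: "tensor3_rel scale [(x, y, z + z')] [(x, y, z), (x, y, z')]"
| scale12: "tensor3_rel scale [(scale c x, y, z)] [(x, scale c y, z)]"
| scale23: "tensor3_rel scale [(x, scale c y, z)] [(x, y, scale c z)]"
| zero: "tensor3_rel scale [(0, y, z)] []"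

definition tensor2_eq ::
  "('k \<Rightarrow> 'a \<Rightarrow> 'a) \<Rightarrow> ('a::ab_group_add \<times> 'a) list \<Rightarrow> ('a \<times> 'a) list \<Rightarrow> bool" where
  "tensor2_eq scale = formal_sum_eq (tensor2_rel scale)"

definition tensor3_eq ::
  "('k \<Rightarrow> 'a \<Rightarrow> 'a) \<Rightarrow> ('a::ab_group_add \<times> 'a \<times> 'a) list \<Rightarrow> ('a \<times> 'a \<times> 'a) list \<Rightarrow> bool" where
  "tensor3_eq scale = formal_sum_eq (tensor3_rel scale)"

text \<open>
  A Sweedler sum \<open>\<Sum> \<beta>(x\<^sub>1, x\<^sub>2)\<close> with \<open>\<beta>\<close> bilinear depends only on the tensor and not on the
  chosen formal sum.
\<close>

lemma tensor2_eq_imp_sum_list_eq: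
  fixes \<beta> :: "'a::ab_group_add \<Rightarrow> 'a \<Rightarrow> 'c::ab_group_add"
  assumes eq: "tensor2_eq scale us vs"
    and add1: "\<And>x x' y. \<beta> (x + x') y = \<beta> x y + \<beta> x' y"
    and add2: "\<And>x y y'. \<beta> x (y + y') = \<beta> x y + \<beta> x y'"
    and balanced: "\<And>c x y. \<beta> (scale c x) y = \<beta> x (scale c y)"
  shows "(\<Sum>(x, y)\<leftarrow>us. \<beta> x y) = (\<Sum>(x, y)\<leftarrow>vs. \<beta> x y)"
proof -
  have zero: "\<beta> 0 y = 0" for y
    using add1[of 0 0 y] by simp
  show ?thesis
    using eq unfolding tensor2_eq_def
  proof induction
    case (base us vs)
    then show ?case
      by cases (simp_all add: add1 add2 balanced zero)
  qed (simp_all add: add.commute)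
qed

text \<open>
  The trace of an endomorphism of a finite-dimensional space, computed in some basis; on an
  infinite-dimensional space the value is not meaningful.
\<close>

definition (in vector_space) endo_trace :: "('b \<Rightarrow> 'b) \<Rightarrow> 'a" where
  "endo_trace f =
    (let B = (SOME B. independent B \<and> span B = UNIV) in \<Sum>b\<in>B. representation B (f b) b)"

text \<open>
  The class \<open>ring_1\<close> demands \<open>0 \<noteq> 1\<close>.  This excludes no biFrobenius algebra, because of the
  axioms that \<open>\<epsilon>\<close> is linear and \<open>\<epsilon>(1) = 1\<close>.
\<close>

locale unital_algebra = vector_space scale
  for scale :: "'k::field \<Rightarrow> 'a::ring_1 \<Rightarrow> 'a" +
  assumes scale_mult_left: "scale c x * y = scale c (x * y)"
    and scale_mult_right: "x * scale c y = scale c (x * y)"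

locale counital_coalgebra = vector_space scale
  for scale :: "'k::field \<Rightarrow> 'a::ab_group_add \<Rightarrow> 'a" +
  fixes \<Delta> :: "'a \<Rightarrow> ('a \<times> 'a) list"
    and \<epsilon> :: "'a \<Rightarrow> 'k"
  assumes Delta_add: "tensor2_eq scale (\<Delta> (x + y)) (\<Delta> x @ \<Delta> y)"
    and Delta_scale: "tensor2_eq scale (\<Delta> (scale c x)) (map (\<lambda>(x1, x2). (scale c x1, x2)) (\<Delta> x))"
    and eps_linear: "Vector_Spaces.linear scale (*) \<epsilon>"
    and coassoc: "tensor3_eq scale
      (concat (map (\<lambda>(x1, x2). map (\<lambda>(a, b). (a, b, x2)) (\<Delta> x1)) (\<Delta> x)))
      (concat (map (\<lambda>(x1, x2). map (\<lambda>(a, b). (x1, a, b)) (\<Delta> x2)) (\<Delta> x)))"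
    and counit_left: "(\<Sum>(x1, x2)\<leftarrow>\<Delta> x. scale (\<epsilon> x1) x2) = x"
    and counit_right: "(\<Sum>(x1, x2)\<leftarrow>\<Delta> x. scale (\<epsilon> x2) x1) = x"

definition dual_action :: "('a::times \<Rightarrow> 'k) \<Rightarrow> 'a \<Rightarrow> 'a \<Rightarrow> 'k"  (infixl "\<leftharpoonup>\<^sup>*" 70) where
  "(l \<leftharpoonup>\<^sup>* x) = (\<lambda>y. l (x * y))"

definition action ::
  "('k \<Rightarrow> 'a \<Rightarrow> 'a) \<Rightarrow> ('a \<Rightarrow> ('a \<times> 'a) list) \<Rightarrow> 'a \<Rightarrow> ('a \<Rightarrow> 'k) \<Rightarrow> 'a::ab_group_add" where
  "action scale \<Delta> x l = (\<Sum>(x1, x2)\<leftarrow>\<Delta> x. scale (l x1) x2)"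

definition convolution ::
  "('a \<Rightarrow> ('a \<times> 'a) list) \<Rightarrow> ('a \<Rightarrow> 'a) \<Rightarrow> ('a \<Rightarrow> 'a) \<Rightarrow> 'a \<Rightarrow> 'a::ring_1" where
  "convolution \<Delta> f g x = (\<Sum>(x1, x2)\<leftarrow>\<Delta> x. f x1 * g x2)"

definition antipode ::
  "('k \<Rightarrow> 'a \<Rightarrow> 'a) \<Rightarrow> ('a \<Rightarrow> ('a \<times> 'a) list) \<Rightarrow> 'a \<Rightarrow> ('a \<Rightarrow> 'k) \<Rightarrow> 'a \<Rightarrow> 'a::ring_1" where
  "antipode scale \<Delta> t \<phi> x = (\<Sum>(t1, t2)\<leftarrow>\<Delta> t. scale (\<phi> (t1 * x)) t2)"

definition algebra_antiautomorphism ::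
  "('k::field \<Rightarrow> 'a \<Rightarrow> 'a) \<Rightarrow> ('a \<Rightarrow> 'a::ring_1) \<Rightarrow> bool" where
  "algebra_antiautomorphism scale f \<longleftrightarrow>
    Vector_Spaces.linear scale scale f \<and> bij f \<and> f 1 = 1 \<and> (\<forall>x y. f (x * y) = f y * f x)"

definition coalgebra_antiautomorphism ::
  "('k::field \<Rightarrow> 'a \<Rightarrow> 'a) \<Rightarrow> ('a \<Rightarrow> ('a \<times> 'a) list) \<Rightarrow> ('a \<Rightarrow> 'k) \<Rightarrow>
    ('a \<Rightarrow> 'a::ab_group_add) \<Rightarrow> bool" where
  "coalgebra_antiautomorphism scale \<Delta> \<epsilon> f \<longleftrightarrow>
    Vector_Spaces.linear scale scale f \<and> bij f \<and> (\<forall>x. \<epsilon> (f x) = \<epsilon> x) \<and>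
    (\<forall>x. tensor2_eq scale (\<Delta> (f x)) (map (\<lambda>(x1, x2). (f x2, f x1)) (\<Delta> x)))"

text \<open>
  Finite-dimensionality is not an axiom: it follows from \<open>coFrobenius\<close>, which says that the
  finitely many \<open>t\<^sub>2\<close> span \<open>H\<close>.
\<close>

locale biFrobenius_algebra = unital_algebra scale + counital_coalgebra scale \<Delta> \<epsilon>
  for scale :: "'k::field \<Rightarrow> 'a::ring_1 \<Rightarrow> 'a"
    and \<Delta> :: "'a \<Rightarrow> ('a \<times> 'a) list"
    and \<epsilon> :: "'a \<Rightarrow> 'k" +
  fixes t :: 'a
    and \<phi> :: "'a \<Rightarrow> 'k"
  assumes phi_linear: "Vector_Spaces.linear scale (*) \<phi>"
    and Frobenius: "{l. Vector_Spaces.linear scale (*) l} = {\<phi> \<leftharpoonup>\<^sup>* x | x. True}"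
    and coFrobenius: "UNIV = {action scale \<Delta> t l | l. Vector_Spaces.linear scale (*) l}"
    and Delta_one: "tensor2_eq scale (\<Delta> 1) [(1, 1)]"
    and eps_one: "\<epsilon> 1 = 1"
    and eps_mult: "\<epsilon> (x * y) = \<epsilon> x * \<epsilon> y"
    and t_action_phi: "action scale \<Delta> t \<phi> = 1"
    and phi_action_t: "\<phi> \<leftharpoonup>\<^sup>* t = \<epsilon>"
    and antipode_algebra: "algebra_antiautomorphism scale (antipode scale \<Delta> t \<phi>)"
    and antipode_coalgebra: "coalgebra_antiautomorphism scale \<Delta> \<epsilon> (antipode scale \<Delta> t \<phi>)"

locale SbF_algebra = biFrobenius_algebra scale \<Delta> \<epsilon> t \<phi>
  for scale :: "'k::field \<Rightarrow> 'a::ring_1 \<Rightarrow> 'a"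
    and \<Delta> :: "'a \<Rightarrow> ('a \<times> 'a) list"
    and \<epsilon> :: "'a \<Rightarrow> 'k"
    and t :: 'a
    and \<phi> :: "'a \<Rightarrow> 'k" +
  assumes antipode_convolution_id: "convolution \<Delta> (antipode scale \<Delta> t \<phi>) id x = scale (\<epsilon> x) 1"
    and id_convolution_antipode: "convolution \<Delta> id (antipode scale \<Delta> t \<phi>) x = scale (\<epsilon> x) 1"

end

theory Submission imports Defs begin

text \<open>
  The formula \<open>\<S> x = \<Sum> \<phi>(t\<^sub>1 x) t\<^sub>2\<close> and bijectivity of \<open>\<S>\<close> give
  \<open>x = \<Sum> \<phi>(t\<^sub>1 \<S>\<inverse> x) t\<^sub>2\<close>, so the \<open>t\<^sub>2\<close> with the functionals \<open>\<phi>(t\<^sub>1 \<S>\<inverse> -)\<close> behave like dual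
  bases: \<open>tr f = \<Sum> \<phi>(t\<^sub>1 \<S>\<inverse> (f t\<^sub>2))\<close> for every endomorphism \<open>f\<close>.  Take \<open>f = \<S>\<^sup>2\<close>.
\<close>

context vector_space
begin

lemma ex_basis: "\<exists>B. independent B \<and> span B = UNIV"
  using basis_exists[of UNIV] by (auto simp: top.extremum_unique)

text \<open>Applying \<open>decomp\<close> to \<open>f x\<close> writes \<open>f\<close> as a sum of
  rank-one maps \<open>x \<mapsto> scale (l i (f x)) (v i)\<close>, and the trace of a rank-one map
  is its functional evaluated at its vector. The \<open>v i\<close> may be dependent or repeated, so
  any formal sum representing a tensor can supply them.\<close>

lemma endo_trace_eq_sum_list:
  assumes f: "Vector_Spaces.linear scale scale f"
    and l: "\<And>i. i \<in> set is \<Longrightarrow> Vector_Spaces.linear scale (*) (l i)"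
    and decomp: "\<And>x. x = (\<Sum>i\<leftarrow>is. scale (l i x) (v i))"
  shows "endo_trace f = (\<Sum>i\<leftarrow>is. l i (f (v i)))"
proof -
  interpret f: Vector_Spaces.linear scale scale f by fact
  define B where "B = (SOME B. independent B \<and> span B = UNIV)"
  have B: "independent B" "span B = UNIV"
    using someI_ex[OF ex_basis] unfolding B_def by auto
  \<comment> \<open>The finitely many \<open>v i\<close> span the space, so the independent set
    \<open>B\<close> is finite; a sum over an infinite \<open>B\<close> would be 0 by
    default.\<close>
  have "(\<Sum>i\<leftarrow>js. scale (c i) (v i)) \<in> span (v ` set js)" for c :: "_ \<Rightarrow> 'a" and js
    by (induction js)
      (auto intro: span_add span_scale span_base subsetD[OF span_mono, rotated])
  then have "B \<subseteq> span (v ` set is)"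
    using decomp by (metis subsetI)
  then have fin: "finite B"
    using independent_span_bound[of "v ` set is" B] B(1) by simp
  have rep: "representation B (\<Sum>i\<leftarrow>js. scale (c i) (v i)) b
      = (\<Sum>i\<leftarrow>js. c i * representation B (v i) b)" for c :: "_ \<Rightarrow> 'a" and js b
    by (induction js)
      (simp_all add: representation_zero representation_add representation_scale B)
  have swap: "(\<Sum>b\<in>B. \<Sum>i\<leftarrow>js. g i b) = (\<Sum>i\<leftarrow>js. \<Sum>b\<in>B. g i b)"
    for g :: "_ \<Rightarrow> _ \<Rightarrow> 'a" and js
    by (induction js) (simp_all add: sum.distrib)
  \<comment> \<open>This is the trace of one rank-one summand: the linear functional
    \<open>l i \<circ> f\<close> is applied to the expansion of \<open>v i\<close> in
    \<open>B\<close>.\<close>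
  have collapse: "(\<Sum>b\<in>B. l i (f b) * representation B (v i) b) = l i (f (v i))"
    if "i \<in> set is" for i
  proof -
    interpret l: Vector_Spaces.linear scale "(*)" "l i" using l that .
    have "v i = (\<Sum>b\<in>B. scale (representation B (v i) b) b)"
      using sum_representation_eq[OF B(1) _ fin order_refl, of "v i"] B(2) by simp
    then have "l i (f (v i)) = l i (f (\<Sum>b\<in>B. scale (representation B (v i) b) b))"
      by simp
    also have "\<dots> = (\<Sum>b\<in>B. l i (f b) * representation B (v i) b)"
      by (simp add: f.sum l.sum f.scale l.scale mult.commute)
    finally show ?thesis by simp
  qed
  have "endo_trace f = (\<Sum>b\<in>B. representation B (f b) b)"
    unfolding endo_trace_def Let_def B_def ..
  also have "\<dots> = (\<Sum>b\<in>B. \<Sum>i\<leftarrow>is. l i (f b) * representation B (v i) b)"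
    \<comment> \<open>The vector expanded by \<open>decomp\<close> is \<open>f b\<close>, so
      \<open>rep\<close> is used with coefficients \<open>l i (f b)\<close>.\<close>
    by (subst decomp) (simp add: rep)
  also have "\<dots> = (\<Sum>i\<leftarrow>is. \<Sum>b\<in>B. l i (f b) * representation B (v i) b)"
    by (rule swap)
  also have "\<dots> = (\<Sum>i\<leftarrow>is. l i (f (v i)))"
    by (intro arg_cong[of _ _ sum_list] map_cong HOL.refl collapse)
  finally show ?thesis .
qed

end

context biFrobenius_algebra
begin

abbreviation S :: "'a \<Rightarrow> 'a" where "S \<equiv> antipode scale \<Delta> t \<phi>"

sublocale phi: Vector_Spaces.linear scale "(*)" \<phi>
  by (rule phi_linear)

sublocale S: Vector_Spaces.linear scale scale S
  using antipode_algebra unfolding algebra_antiautomorphism_def by blast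

lemma bij_S: "bij S"
  using antipode_algebra unfolding algebra_antiautomorphism_def by blast

lemma S_inv_S: "S (inv S x) = x"
  by (meson bij_S bij_is_surj surj_f_inv_f)

lemma inv_S_S: "inv S (S x) = x"
  by (meson bij_S bij_is_inj inv_f_f)

lemma inv_S_add: "inv S (x + y) = inv S x + inv S y"
  by (metis S.add S_inv_S inv_S_S)

lemma inv_S_scale: "inv S (scale c x) = scale c (inv S x)"
  by (metis S.scale S_inv_S inv_S_S)

lemma endo_trace_eq:
  assumes "Vector_Spaces.linear scale scale f"
  shows "endo_trace f = (\<Sum>(t1, t2)\<leftarrow>\<Delta> t. \<phi> (t1 * inv S (f t2)))"
proof -
  \<comment> \<open>The pairs in \<open>\<Delta> t\<close> themselves serve as indices, with
    \<open>snd\<close> giving the vectors.\<close>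
  let ?l = "\<lambda>(p :: 'a \<times> 'a) x. \<phi> (fst p * inv S x)"
  have "Vector_Spaces.linear scale (*) (?l p)" for p
    by unfold_locales
      (simp_all add: inv_S_add inv_S_scale distrib_left scale_mult_right
        phi.add phi.scale)
  moreover have "x = (\<Sum>p\<leftarrow>\<Delta> t. scale (?l p x) (snd p))" for x
    using S_inv_S[of x] by (simp add: antipode_def case_prod_unfold)
  ultimately have "endo_trace f = (\<Sum>p\<leftarrow>\<Delta> t. ?l p (f (snd p)))"
    by (intro endo_trace_eq_sum_list assms)
  then show ?thesis by (simp add: case_prod_unfold)
qed

text \<open>In \<open>endo_trace_eq\<close> one factor of \<open>S \<circ> S\<close> cancels against
  \<open>inv S\<close>, leaving the sum of the \<open>\<phi> (t1 * S t2)\<close>; linearity moves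
  \<open>\<phi>\<close> outside.\<close>

theorem endo_trace_S_squared: "endo_trace (S \<circ> S) = \<phi> (convolution \<Delta> id S t)"
proof -
  have "Vector_Spaces.linear scale scale (S \<circ> S)"
    by (rule Vector_Spaces.linear_compose[OF S.linear_axioms S.linear_axioms])
  moreover have "\<phi> (\<Sum>p\<leftarrow>ps. g p) = (\<Sum>p\<leftarrow>ps. \<phi> (g p))" for g and ps :: "('a \<times> 'a) list"
    by (induction ps) (simp_all add: phi.add)
  ultimately show ?thesis
    by (simp add: endo_trace_eq convolution_def inv_S_S case_prod_unfold)
qed

end

theorem theorem1:
  fixes scale :: "'k::field \<Rightarrow> 'a::ring_1 \<Rightarrow> 'a"
    and \<Delta> :: "'a \<Rightarrow> ('a \<times> 'a) list"
    and \<epsilon> :: "'a \<Rightarrow> 'k"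
    and t :: 'a
    and \<phi> :: "'a \<Rightarrow> 'k"
    and \<S> :: "'a \<Rightarrow> 'a"
  assumes "biFrobenius_algebra scale \<Delta> \<epsilon> t \<phi>"
    and "\<S> = antipode scale \<Delta> t \<phi>"
  shows "vector_space.endo_trace scale (\<S> \<circ> \<S>) = \<phi> (convolution \<Delta> id \<S> t) \<and>
    (SbF_algebra scale \<Delta> \<epsilon> t \<phi> \<longrightarrow>
      vector_space.endo_trace scale (\<S> \<circ> \<S>) = \<epsilon> t * \<phi> 1)"
proof -
  interpret biFrobenius_algebra scale \<Delta> \<epsilon> t \<phi> by fact
  show ?thesis
    unfolding assms(2)
    \<comment> \<open>For type S the convolution at \<open>t\<close> is
      \<open>scale (\<epsilon> t) 1\<close>, and \<open>\<phi>\<close> pulls out the scalar.\<close>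
    by (simp add: endo_trace_S_squared SbF_algebra.id_convolution_antipode phi.scale)
qed

end
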